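(* Let $d\ge 0$ and let $\mathcal{F}$ be a graph class closed under taking subgraphs. If $\mathcal{F}$ is closed under weak oddomorphisms, then so is the class of all graphs $F$ with $\mathrm{ed}_{\mathcal{F}}(F)\le d$.
   Context: All graphs are finite, simple, undirected and loopless. The elimination distance $\mathrm{ed}_{\mathcal{F}}(F)$ of a graph $F$ to $\mathcal{F}$ is: $0$ if $F\in\mathcal{F}$; otherwise $1+\min_{v\in V(F)}\mathrm{ed}_{\mathcal{F}}(F-v)$ if $F$ is connected; and $\max_i\mathrm{ed}_{\mathcal{F}}(F_i)$ if $F$ is disconnected with connected components $F_i$. Let $\phi\colon F\to G$ be a homomorphism. A vertex $a\in V(F)$ is $\phi$-odd (resp. $\phi$-even) if $|N_F(a)\cap\phi^{-1}(v)|$ is odd (resp. even) for every $v\in N_G(\phi(a))$. $\phi$ is an oddomorphism if every vertex of $F$ is $\phi$-odd or $\phi$-even and every fibre $\phi^{-1}(v)$, $v\in V(G)$, contains an odd number of $\phi$-odd vertices. $\phi$ is a weak oddomorphism if its restriction to some subgraph $F'$ of $F$ is an oddomorphism $F'\to G$. A class $\mathcal{C}$ is closed under weak oddomorphisms if $F\in\mathcal{C}$ and a weak oddomorphism $F\to G$ imply $G\in\mathcal{C}$. *)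

theory Defs
  imports "Graph_Theory.Digraph_Component"
begin

text \<open>
  A finite simple undirected loopless graph is a \<^term>\<open>pair_graph\<close>: a finite set of vertices with
  a symmetric irreflexive arc relation on it, an edge \<open>{u, v}\<close> being the two arcs \<open>(u, v)\<close> and
  \<open>(v, u)\<close>. The empty graph is allowed. A subgraph has to be a \<^term>\<open>pair_graph\<close> itself, as the
  library relation \<^term>\<open>subgraph\<close> alone could drop one of the two arcs of an edge.
\<close>

definition is_subgraph :: "'a pair_pre_digraph \<Rightarrow> 'a pair_pre_digraph \<Rightarrow> bool" where
  "is_subgraph H G \<longleftrightarrow> pair_graph H \<and> pair_graph G \<and> subgraph (with_proj H) (with_proj G)"

definition neighbourhood :: "'a pair_pre_digraph \<Rightarrow> 'a \<Rightarrow> 'a set" where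
  "neighbourhood G v = {u. (v, u) \<in> parcs G}"

definition delete_vertex :: "'a pair_pre_digraph \<Rightarrow> 'a \<Rightarrow> 'a pair_pre_digraph" where
  "delete_vertex G v =
    \<lparr>pverts = pverts G - {v}, parcs = {e \<in> parcs G. fst e \<noteq> v \<and> snd e \<noteq> v}\<rparr>"

lemma with_proj_delete_vertex:
  "with_proj (delete_vertex G v) = pre_digraph.del_vert (with_proj G) v"
  by (simp add: delete_vertex_def pre_digraph.del_vert_def with_proj_def)

lemma card_delete_vertex_less:
  assumes "pair_graph G" "v \<in> pverts G"
  shows "card (pverts (delete_vertex G v)) < card (pverts G)"
proof -
  interpret pair_graph G by fact
  show ?thesis
    using pair_finite_verts assms(2) by (simp add: delete_vertex_def card_Diff1_less del: card_Diff_insert)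
qed

definition components :: "'a pair_pre_digraph \<Rightarrow> 'a pair_pre_digraph set" where
  "components G = {H. pair_graph H \<and> pre_digraph.max_subgraph (with_proj G) connected (with_proj H)}"

lemma card_component_less:
  assumes "pair_graph G" "\<not> connected (with_proj G)" "H \<in> components G"
  shows "card (pverts H) < card (pverts G)"
proof -
  interpret pair_graph G by fact
  have sub: "subgraph (with_proj H) (with_proj G)" and con: "connected (with_proj H)"
    using assms(3) by (auto simp: components_def pre_digraph.max_subgraph_def)
  have "pverts H \<subseteq> pverts G"
    using subgraph_imp_subverts[OF sub] by simp
  moreover have "pverts H \<noteq> pverts G"
  proof
    assume "pverts H = pverts G"
    then have "spanning (with_proj H) (with_proj G)"
      using sub by (simp add: spanning_def)
    then show False
      using connected_spanning_imp_connected con assms(2) by blast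
  qed
  ultimately show ?thesis
    using pair_finite_verts by (simp add: psubset_card_mono psubset_eq)
qed

text \<open>
  \<^term>\<open>connected\<close> excludes the empty graph, which has no components either. If the empty graph
  is not in \<open>\<F>\<close> it gets the value 0, the maximum over no components. For a subgraph-closed \<open>\<F>\<close>
  this happens only if \<open>\<F>\<close> is empty, and the elimination distance is then the tree-depth.
  The value at a record that is not a graph is immaterial.
\<close>

function elim_dist :: "'a pair_pre_digraph set \<Rightarrow> 'a pair_pre_digraph \<Rightarrow> nat" where
  "elim_dist \<F> F =
    (if \<not> pair_graph F then undefined
     else if F \<in> \<F> \<or> pverts F = {} then 0
     else if connected (with_proj F) then 1 + (MIN v\<in>pverts F. elim_dist \<F> (delete_vertex F v))
     else (MAX H\<in>components F. elim_dist \<F> H))"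
  by pat_completeness auto
termination
  by (relation "measure (\<lambda>(\<F>, F). card (pverts F))")
    (auto intro: card_delete_vertex_less card_component_less)

declare elim_dist.simps [simp del]

definition graph_hom :: "'a pair_pre_digraph \<Rightarrow> 'b pair_pre_digraph \<Rightarrow> ('a \<Rightarrow> 'b) \<Rightarrow> bool" where
  "graph_hom F G \<phi> \<longleftrightarrow> pair_graph F \<and> pair_graph G \<and> (\<forall>a\<in>pverts F. \<phi> a \<in> pverts G) \<and>
    (\<forall>a b. (a, b) \<in> parcs F \<longrightarrow> (\<phi> a, \<phi> b) \<in> parcs G)"

definition fibre :: "'a pair_pre_digraph \<Rightarrow> ('a \<Rightarrow> 'b) \<Rightarrow> 'b \<Rightarrow> 'a set" where
  "fibre F \<phi> v = {a \<in> pverts F. \<phi> a = v}"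

definition hom_odd :: "'a pair_pre_digraph \<Rightarrow> 'b pair_pre_digraph \<Rightarrow> ('a \<Rightarrow> 'b) \<Rightarrow> 'a \<Rightarrow> bool" where
  "hom_odd F G \<phi> a \<longleftrightarrow>
    (\<forall>v\<in>neighbourhood G (\<phi> a). odd (card (neighbourhood F a \<inter> fibre F \<phi> v)))"

definition hom_even :: "'a pair_pre_digraph \<Rightarrow> 'b pair_pre_digraph \<Rightarrow> ('a \<Rightarrow> 'b) \<Rightarrow> 'a \<Rightarrow> bool" where
  "hom_even F G \<phi> a \<longleftrightarrow>
    (\<forall>v\<in>neighbourhood G (\<phi> a). even (card (neighbourhood F a \<inter> fibre F \<phi> v)))"

definition oddomorphism :: "'a pair_pre_digraph \<Rightarrow> 'b pair_pre_digraph \<Rightarrow> ('a \<Rightarrow> 'b) \<Rightarrow> bool" where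
  "oddomorphism F G \<phi> \<longleftrightarrow> graph_hom F G \<phi> \<and>
    (\<forall>a\<in>pverts F. hom_odd F G \<phi> a \<or> hom_even F G \<phi> a) \<and>
    (\<forall>v\<in>pverts G. odd (card {a \<in> fibre F \<phi> v. hom_odd F G \<phi> a}))"

text \<open>
  Only the values of \<open>\<phi>\<close> on the vertices of its domain graph matter in \<^term>\<open>oddomorphism\<close>,
  so the restriction of \<open>\<phi>\<close> to \<open>F'\<close> is again written \<open>\<phi>\<close>.
\<close>

definition weak_oddomorphism ::
  "'a pair_pre_digraph \<Rightarrow> 'b pair_pre_digraph \<Rightarrow> ('a \<Rightarrow> 'b) \<Rightarrow> bool" where
  "weak_oddomorphism F G \<phi> \<longleftrightarrow> graph_hom F G \<phi> \<and> (\<exists>F'. is_subgraph F' F \<and> oddomorphism F' G \<phi>)"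

definition graph_class :: "'a pair_pre_digraph set \<Rightarrow> bool" where
  "graph_class \<C> \<longleftrightarrow> (\<forall>F\<in>\<C>. pair_graph F)"

definition subgraph_closed :: "'a pair_pre_digraph set \<Rightarrow> bool" where
  "subgraph_closed \<C> \<longleftrightarrow> (\<forall>F H. F \<in> \<C> \<and> is_subgraph H F \<longrightarrow> H \<in> \<C>)"

text \<open>
  An isomorphism is an oddomorphism, so this closure property includes closure under isomorphism.
\<close>

definition weak_oddomorphism_closed :: "'a pair_pre_digraph set \<Rightarrow> bool" where
  "weak_oddomorphism_closed \<C> \<longleftrightarrow>
    (\<forall>F G. F \<in> \<C> \<and> (\<exists>\<phi>. weak_oddomorphism F G \<phi>) \<longrightarrow> G \<in> \<C>)"

end

theory Submission
  imports Defs
begin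

text \<open>
  Double counting the edges between two fibres of an oddomorphism \<open>F \<rightarrow> G\<close> shows that within a
  connected component of \<open>F\<close> the number of odd vertices has the same parity in the fibres over
  any two adjacent vertices of \<open>G\<close>; hence, if \<open>G\<close> is connected, some component of \<open>F\<close> already maps
  to \<open>G\<close> by an oddomorphism. Moreover an oddomorphism restricts, up to discarding some even
  vertices, to the preimage of any vertex set of \<open>G\<close>. Consequently an elimination of \<open>F\<close> can be
  imitated on \<open>G\<close>: when \<open>v\<close> is deleted from \<open>F\<close>, delete \<open>\<phi> v\<close> from \<open>G\<close>.
\<close>

section \<open>Subgraphs and components\<close>

lemma pair_graph_iff:
  "pair_graph G \<longleftrightarrow>
    finite (pverts G) \<and> parcs G \<subseteq> pverts G \<times> pverts G \<and> sym (parcs G) \<and> irrefl (parcs G)"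
  (is "_ \<longleftrightarrow> ?simple")
proof
  assume "pair_graph G"
  then interpret pair_graph G .
  show ?simple
    using pair_finite_verts in_arcsD1 in_arcsD2 arcs_symmetric
    by (auto simp: sym_def irrefl_def dest: no_loops')
next
  assume simple: ?simple
  then have "finite (parcs G)"
    by (meson finite_SigmaI finite_subset)
  with simple show "pair_graph G"
    by unfold_locales (auto simp: symmetric_def irrefl_def)
qed

lemma is_subgraph_iff:
  "is_subgraph H G \<longleftrightarrow>
    pair_graph H \<and> pair_graph G \<and> pverts H \<subseteq> pverts G \<and> parcs H \<subseteq> parcs G"
  by (auto simp: is_subgraph_def subgraph_def compatible_def wf_digraph_wp_iff pair_graph_def
      pair_digraph_def pair_fin_digraph_def)

lemma is_subgraph_refl: "pair_graph G \<Longrightarrow> is_subgraph G G"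
  by (simp add: is_subgraph_iff)

lemma is_subgraph_trans: "is_subgraph G H \<Longrightarrow> is_subgraph H K \<Longrightarrow> is_subgraph G K"
  by (auto simp: is_subgraph_iff)

definition induced :: "'a pair_pre_digraph \<Rightarrow> 'a set \<Rightarrow> 'a pair_pre_digraph" where
  "induced G S = \<lparr>pverts = pverts G \<inter> S, parcs = parcs G \<inter> S \<times> S\<rparr>"

lemma induced_simps [simp]:
  "pverts (induced G S) = pverts G \<inter> S"
  "parcs (induced G S) = parcs G \<inter> S \<times> S"
  by (simp_all add: induced_def)

lemma pair_graph_induced: "pair_graph G \<Longrightarrow> pair_graph (induced G S)"
  by (auto simp: pair_graph_iff sym_def irrefl_def)

lemma is_subgraph_induced: "pair_graph G \<Longrightarrow> is_subgraph (induced G S) G"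
  by (auto simp: is_subgraph_iff pair_graph_induced)

lemma is_subgraph_induced_iff:
  "pair_graph G \<Longrightarrow> is_subgraph H (induced G S) \<longleftrightarrow> is_subgraph H G \<and> pverts H \<subseteq> S"
  by (auto simp: is_subgraph_iff pair_graph_induced) (auto simp: pair_graph_iff)

lemma delete_vertex_eq_induced: "pair_graph G \<Longrightarrow> delete_vertex G v = induced G (- {v})"
  by (auto simp: delete_vertex_def induced_def)

lemma strongly_connected_imp_connected:
  assumes "strongly_connected G"
  shows "connected G"
  using assms rtrancl_on_mono[of "arcs_ends G" "(arcs_ends G)\<^sup>s" "verts G" "verts G"]
  by (auto simp: strongly_connected_def connected_conv reachable_def symcl_def)

lemma arc_mono_connected: "arc_mono connected"
  unfolding arc_mono_def
  by (metis spanning_def subgraphE wf_digraph.connected_spanning_imp_connected)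

lemma (in sym_digraph) connected_iff_strongly_connected: "connected G \<longleftrightarrow> strongly_connected G"
  using symmetric_connected_imp_strongly_connected[OF sym_arcs] strongly_connected_imp_connected
  by blast

lemma (in sym_digraph) max_subgraph_connected_iff_sccs:
  "max_subgraph connected H \<longleftrightarrow> H \<in> sccs"
proof
  assume max: "max_subgraph connected H"
  then have "induced_subgraph H G"
    by (rule induced_subgraphI_arc_mono[OF _ arc_mono_connected])
  then have "strongly_connected H"
    using max_subgraph_prop[OF max] induced_graph_imp_graph
    by (simp add: sym_digraph.connected_iff_strongly_connected)
  with max show "H \<in> sccs"
    unfolding sccs_altdef2 by (auto intro: max_subgraph_mp strongly_connected_imp_connected)
next
  assume H: "H \<in> sccs"
  have "\<not> connected K" if K: "H \<noteq> K" "subgraph H K" "subgraph K G" for K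
  proof
    assume "connected K"
    have K_induced: "subgraph K (G \<restriction> verts K)" "induced_subgraph (G \<restriction> verts K) G"
      using K(3) by (auto intro: subgraph_induce_subgraphI2)
    then have "connected (G \<restriction> verts K)"
      using arc_mono_connected \<open>connected K\<close> unfolding arc_mono_def
      by (metis induce_subgraph_verts)
    then have "strongly_connected (G \<restriction> verts K)"
      using induced_graph_imp_graph[OF K_induced(2)]
      by (simp add: sym_digraph.connected_iff_strongly_connected)
    then have "\<not> verts H \<subset> verts K"
      using H K_induced(2) by (metis in_sccsE induce_subgraph_verts)
    then have "verts H = verts K"
      using subgraph_imp_subverts[OF K(2)] by blast
    then show False
      using K in_sccs_imp_induced[OF H] by (auto simp: induced_subgraph_altdef2 max_subgraph_def)
  qed
  with H show "max_subgraph connected H"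
    by (auto intro!: max_subgraphI strongly_connected_imp_connected)
qed

lemma with_proj_eq_iff: "with_proj G = with_proj H \<longleftrightarrow> G = H"
  by (auto simp: with_proj_def)

lemma with_proj_induced:
  "S \<subseteq> pverts G \<Longrightarrow> with_proj (induced G S) = with_proj G \<restriction> S"
  by (auto simp: with_proj_def induced_def induce_subgraph_def)

lemma component_imp_connected: "C \<in> components G \<Longrightarrow> connected (with_proj C)"
  by (simp add: components_def pre_digraph.max_subgraph_def)

context pair_graph
begin

lemma components_eq_induced_sccs_verts: "components G = induced G ` sccs_verts"
proof -
  have "C \<in> components G \<longleftrightarrow> C \<in> induced G ` sccs_verts" for C
  proof -
    have "C \<in> components G \<longleftrightarrow> pair_graph C \<and> (\<exists>S\<in>sccs_verts. with_proj C = with_proj G \<restriction> S)"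
      unfolding components_def
      by (auto simp: max_subgraph_connected_iff_sccs sccs_conv_sccs_verts)
    also have "\<dots> \<longleftrightarrow> pair_graph C \<and> (\<exists>S\<in>sccs_verts. C = induced G S)"
      using sccs_verts_subsets by (metis with_proj_eq_iff with_proj_induced)
    finally show ?thesis
      using pair_graph_induced[OF pair_graph] by blast
  qed
  then show ?thesis
    by blast
qed

lemma finite_components: "finite (components G)"
  by (simp add: components_eq_induced_sccs_verts finite_sccs_verts)

lemma components_disjoint:
  assumes "C \<in> components G" "D \<in> components G" "C \<noteq> D"
  shows "pverts C \<inter> pverts D = {}"
  using assms sccs_verts_disjoint by (fastforce simp: components_eq_induced_sccs_verts)

lemma Union_pverts_components: "(\<Union>C\<in>components G. pverts C) = pverts G"
  using scc_of_in_sccs_verts in_scc_of_self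
  by (fastforce simp: components_eq_induced_sccs_verts)

lemma component_eq_induced: "C \<in> components G \<Longrightarrow> C = induced G (pverts C)"
  by (auto simp: components_eq_induced_sccs_verts induced_def dest: in_arcsD1 in_arcsD2)

lemma is_subgraph_component: "C \<in> components G \<Longrightarrow> is_subgraph C G"
  by (metis component_eq_induced is_subgraph_induced pair_graph)

lemma reachable_imp_in_component:
  assumes "C \<in> components G" "u \<in> pverts C" "u \<rightarrow>\<^sup>*\<^bsub>with_proj G\<^esub> v"
  shows "v \<in> pverts C"
  using assms symmetric_reachable' reachable_in_verts
  by (fastforce simp: components_eq_induced_sccs_verts in_sccs_verts_conv_reachable)

lemma neighbourhood_subset_component:
  assumes "C \<in> components G" "a \<in> pverts C"
  shows "neighbourhood G a \<subseteq> pverts C"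
  using reachable_imp_in_component[OF assms] by (auto simp: neighbourhood_def)

lemma neighbourhood_component:
  assumes "C \<in> components G" "a \<in> pverts C"
  shows "neighbourhood C a = neighbourhood G a"
  using neighbourhood_subset_component[OF assms] assms(2)
  by (subst component_eq_induced[OF assms(1)]) (auto simp: neighbourhood_def)

lemma components_eq_singleton: "connected (with_proj G) \<Longrightarrow> components G = {G}"
  using pair_graph
  by (auto simp: components_def max_subgraph_connected_iff_sccs connected_iff_strongly_connected
      strongly_connected_eq_iff with_proj_eq_iff)

lemma connected_subgraph_of_component:
  assumes "is_subgraph H G" "connected (with_proj H)"
  obtains C where "C \<in> components G" "is_subgraph H C"
proof -
  interpret H: pair_graph H
    using assms(1) by (simp add: is_subgraph_def)
  obtain u where u: "u \<in> pverts H"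
    using assms(2) by (auto simp: connected_conv)
  then have "u \<in> pverts G"
    using assms(1) by (auto simp: is_subgraph_iff)
  then obtain C where C: "C \<in> components G" "u \<in> pverts C"
    using Union_pverts_components by blast
  have "pverts H \<subseteq> pverts C"
  proof
    fix v
    assume "v \<in> pverts H"
    then have "u \<rightarrow>\<^sup>*\<^bsub>with_proj H\<^esub> v"
      using assms(2) u by (auto simp: H.connected_iff_strongly_connected)
    then have "u \<rightarrow>\<^sup>*\<^bsub>with_proj G\<^esub> v"
      using assms(1) by (auto simp: is_subgraph_def intro: reachable_mono)
    with C show "v \<in> pverts C"
      by (rule reachable_imp_in_component)
  qed
  then have "is_subgraph H C"
    using assms(1) is_subgraph_induced_iff[OF pair_graph] component_eq_induced[OF C(1)] by metis
  with C(1) show thesis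
    by (rule that)
qed

end

section \<open>Homomorphisms with odd and even vertices\<close>

abbreviation fibre_neighbours :: "'a pair_pre_digraph \<Rightarrow> ('a \<Rightarrow> 'b) \<Rightarrow> 'a \<Rightarrow> 'b \<Rightarrow> 'a set" where
  "fibre_neighbours F \<phi> a v \<equiv> neighbourhood F a \<inter> fibre F \<phi> v"

definition odd_fibre ::
  "'a pair_pre_digraph \<Rightarrow> 'b pair_pre_digraph \<Rightarrow> ('a \<Rightarrow> 'b) \<Rightarrow> 'b \<Rightarrow> 'a set" where
  "odd_fibre F G \<phi> v = {a \<in> fibre F \<phi> v. hom_odd F G \<phi> a}"

definition parity_hom :: "'a pair_pre_digraph \<Rightarrow> 'b pair_pre_digraph \<Rightarrow> ('a \<Rightarrow> 'b) \<Rightarrow> bool" where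
  "parity_hom F G \<phi> \<longleftrightarrow> graph_hom F G \<phi> \<and> (\<forall>a\<in>pverts F. hom_odd F G \<phi> a \<or> hom_even F G \<phi> a)"

lemma parity_hom_pair_graph:
  assumes "parity_hom F G \<phi>"
  shows "pair_graph F" "pair_graph G"
  using assms by (auto simp: parity_hom_def graph_hom_def)

lemma oddomorphism_iff_odd_fibres:
  "oddomorphism F G \<phi> \<longleftrightarrow> parity_hom F G \<phi> \<and> (\<forall>v\<in>pverts G. odd (card (odd_fibre F G \<phi> v)))"
  by (simp add: oddomorphism_def parity_hom_def odd_fibre_def)

lemma finite_fibre: "pair_graph F \<Longrightarrow> finite (fibre F \<phi> v)"
  by (simp add: fibre_def pair_graph_iff)

lemma hom_odd_iff_fibre_neighbours:
  assumes "parity_hom F G \<phi>" "a \<in> pverts F" "v \<in> neighbourhood G (\<phi> a)"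
  shows "hom_odd F G \<phi> a \<longleftrightarrow> odd (card (fibre_neighbours F \<phi> a v))"
  using assms by (auto simp: parity_hom_def hom_odd_def hom_even_def)

lemma sum_card_fibre_neighbours_swap:
  assumes "pair_graph F"
  shows "(\<Sum>a\<in>fibre F \<phi> u. card (fibre_neighbours F \<phi> a v)) =
    (\<Sum>b\<in>fibre F \<phi> v. card (fibre_neighbours F \<phi> b u))"
proof -
  have fibre_neighbours:
    "fibre_neighbours F \<phi> a v = {b \<in> fibre F \<phi> v. (a, b) \<in> parcs F}"
    "fibre_neighbours F \<phi> b u = {a \<in> fibre F \<phi> u. (a, b) \<in> parcs F}" for a b
    using assms by (auto simp: neighbourhood_def pair_graph_iff dest: symD)
  show ?thesis
    unfolding fibre_neighbours card_eq_sum
    by (rule sum.swap_restrict) (simp_all add: finite_fibre[OF assms])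
qed

lemma odd_card_odd_fibre_adjacent:
  assumes "parity_hom F G \<phi>" "(u, v) \<in> parcs G"
  shows "odd (card (odd_fibre F G \<phi> u)) \<longleftrightarrow> odd (card (odd_fibre F G \<phi> v))"
proof -
  note graphs = parity_hom_pair_graph[OF assms(1)]
  have odd_sum_iff: "odd (\<Sum>a\<in>fibre F \<phi> x. card (fibre_neighbours F \<phi> a y)) \<longleftrightarrow>
      odd (card (odd_fibre F G \<phi> x))" if "(x, y) \<in> parcs G" for x y
  proof -
    have "odd_fibre F G \<phi> x = {a \<in> fibre F \<phi> x. odd (card (fibre_neighbours F \<phi> a y))}"
      using hom_odd_iff_fibre_neighbours[OF assms(1)] that
      by (auto simp: odd_fibre_def fibre_def neighbourhood_def)
    then show ?thesis
      by (simp add: even_sum_iff finite_fibre[OF graphs(1)])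
  qed
  have "(v, u) \<in> parcs G"
    using graphs(2) assms(2) by (auto simp: pair_graph_iff dest: symD)
  then show ?thesis
    using odd_sum_iff[OF assms(2)] odd_sum_iff[of v u]
    by (simp add: sum_card_fibre_neighbours_swap[OF graphs(1), of \<phi> u v])
qed

lemma odd_card_odd_fibre_connected:
  assumes "parity_hom F G \<phi>" "connected (with_proj G)" "u \<in> pverts G" "v \<in> pverts G"
  shows "odd (card (odd_fibre F G \<phi> u)) \<longleftrightarrow> odd (card (odd_fibre F G \<phi> v))"
proof -
  interpret pair_graph G
    using assms(1) by (rule parity_hom_pair_graph)
  have "u \<rightarrow>\<^sup>*\<^bsub>with_proj G\<^esub> v"
    using assms(2-) by (auto simp: connected_iff_strongly_connected)
  then show ?thesis
    by induction (blast dest: odd_card_odd_fibre_adjacent[OF assms(1)])+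
qed

section \<open>Oddomorphisms from a component\<close>

lemma hom_parity_component:
  assumes "pair_graph F" "C \<in> components F" "a \<in> pverts C"
  shows "hom_odd C G \<phi> a \<longleftrightarrow> hom_odd F G \<phi> a" "hom_even C G \<phi> a \<longleftrightarrow> hom_even F G \<phi> a"
proof -
  interpret pair_graph F by fact
  have "fibre_neighbours C \<phi> a v = fibre_neighbours F \<phi> a v" for v
    using neighbourhood_component[OF assms(2,3)] neighbourhood_subset_component[OF assms(2,3)]
      is_subgraph_component[OF assms(2)]
    by (auto simp: fibre_def is_subgraph_iff)
  then show "hom_odd C G \<phi> a \<longleftrightarrow> hom_odd F G \<phi> a" "hom_even C G \<phi> a \<longleftrightarrow> hom_even F G \<phi> a"
    by (simp_all add: hom_odd_def hom_even_def)
qed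

lemma graph_hom_subgraph: "graph_hom F G \<phi> \<Longrightarrow> is_subgraph H F \<Longrightarrow> graph_hom H G \<phi>"
  by (auto simp: graph_hom_def is_subgraph_iff)

lemma parity_hom_component:
  assumes "parity_hom F G \<phi>" "C \<in> components F"
  shows "parity_hom C G \<phi>"
proof -
  note F = parity_hom_pair_graph(1)[OF assms(1)]
  then have "is_subgraph C F"
    using assms(2) by (rule pair_graph.is_subgraph_component)
  then show ?thesis
    using assms(1) graph_hom_subgraph
    by (auto simp: parity_hom_def is_subgraph_iff hom_parity_component[OF F assms(2)])
qed

lemma odd_fibre_component:
  assumes "pair_graph F" "C \<in> components F"
  shows "odd_fibre C G \<phi> v = odd_fibre F G \<phi> v \<inter> pverts C"
  using hom_parity_component(1)[OF assms] pair_graph.is_subgraph_component[OF assms]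
  by (auto simp: odd_fibre_def fibre_def is_subgraph_iff)

lemma card_odd_fibre_eq_sum_components:
  assumes "pair_graph F"
  shows "card (odd_fibre F G \<phi> v) = (\<Sum>C\<in>components F. card (odd_fibre C G \<phi> v))"
proof -
  interpret pair_graph F by fact
  have "odd_fibre F G \<phi> v \<subseteq> pverts F"
    by (auto simp: odd_fibre_def fibre_def)
  then have "odd_fibre F G \<phi> v = (\<Union>C\<in>components F. odd_fibre C G \<phi> v)"
    using Union_pverts_components by (auto simp: odd_fibre_component[OF assms])
  also have "card \<dots> = (\<Sum>C\<in>components F. card (odd_fibre C G \<phi> v))"
  proof (rule card_UN_disjoint[OF finite_components], safe)
    fix C assume "C \<in> components F"
    then show "finite (odd_fibre C G \<phi> v)"
      by (simp add: odd_fibre_component[OF assms] odd_fibre_def[of F] finite_fibre[OF assms])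
  next
    fix C D a
    assume "C \<in> components F" "D \<in> components F" "C \<noteq> D"
      and "a \<in> odd_fibre C G \<phi> v" "a \<in> odd_fibre D G \<phi> v"
    then show "a \<in> {}"
      using components_disjoint by (auto simp: odd_fibre_component[OF assms])
  qed
  finally show ?thesis .
qed

lemma oddomorphism_component:
  assumes "oddomorphism F G \<phi>" "connected (with_proj G)"
  obtains C where "C \<in> components F" "oddomorphism C G \<phi>"
proof -
  have par: "parity_hom F G \<phi>"
    and odd_fibres: "\<And>v. v \<in> pverts G \<Longrightarrow> odd (card (odd_fibre F G \<phi> v))"
    using assms(1) by (auto simp: oddomorphism_iff_odd_fibres)
  note F = parity_hom_pair_graph(1)[OF par]
  obtain w where w: "w \<in> pverts G"
    using assms(2) by (auto simp: connected_conv)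
  have "odd (\<Sum>C\<in>components F. card (odd_fibre C G \<phi> w))"
    using odd_fibres[OF w] by (simp add: card_odd_fibre_eq_sum_components[OF F])
  then obtain C where C: "C \<in> components F" "odd (card (odd_fibre C G \<phi> w))"
    by (meson dvd_sum)
  have "parity_hom C G \<phi>"
    using par C(1) by (rule parity_hom_component)
  with C w have "oddomorphism C G \<phi>"
    using odd_card_odd_fibre_connected[OF _ assms(2)] unfolding oddomorphism_iff_odd_fibres by blast
  with C(1) show thesis
    by (rule that)
qed

section \<open>Restricting an oddomorphism to an induced subgraph of its target\<close>

text \<open>
  The full preimage of \<open>S\<close> does not do: a vertex over an isolated vertex of \<^term>\<open>induced G S\<close> is
  both odd and even, so the vertices there that are even for \<open>G\<close> would be counted as odd.
\<close>

definition pruned_vimage ::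
  "'a pair_pre_digraph \<Rightarrow> 'b pair_pre_digraph \<Rightarrow> ('a \<Rightarrow> 'b) \<Rightarrow> 'b set \<Rightarrow> 'a pair_pre_digraph" where
  "pruned_vimage F G \<phi> S =
    induced F {a \<in> \<phi> -` S. hom_odd F G \<phi> a \<or> neighbourhood (induced G S) (\<phi> a) \<noteq> {}}"

lemma pverts_pruned_vimageD:
  assumes "a \<in> pverts (pruned_vimage F G \<phi> S)"
  shows "a \<in> pverts F"
    and "hom_odd F G \<phi> a \<or> neighbourhood (induced G S) (\<phi> a) \<noteq> {}"
  using assms by (auto simp: pruned_vimage_def)

lemma is_subgraph_pruned_vimage:
  "pair_graph F \<Longrightarrow> is_subgraph (pruned_vimage F G \<phi> S) (induced F (\<phi> -` S))"
  by (auto simp: pruned_vimage_def is_subgraph_induced_iff is_subgraph_induced)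

lemma graph_hom_pruned_vimage:
  "graph_hom F G \<phi> \<Longrightarrow> graph_hom (pruned_vimage F G \<phi> S) (induced G S) \<phi>"
  by (auto simp: graph_hom_def pruned_vimage_def pair_graph_induced)

lemma fibre_neighbours_pruned_vimage:
  assumes "pair_graph G" "a \<in> pverts (pruned_vimage F G \<phi> S)"
    and "v \<in> neighbourhood (induced G S) (\<phi> a)"
  shows "fibre_neighbours (pruned_vimage F G \<phi> S) \<phi> a v = fibre_neighbours F \<phi> a v"
proof -
  have "v \<in> S" "\<phi> a \<in> neighbourhood (induced G S) v"
    using assms(1,3) by (auto simp: neighbourhood_def pair_graph_iff dest: symD)
  then show ?thesis
    using assms(2) by (auto simp: pruned_vimage_def neighbourhood_def fibre_def)
qed

lemma hom_odd_pruned_vimage_iff: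
  assumes "parity_hom F G \<phi>" "a \<in> pverts (pruned_vimage F G \<phi> S)"
  shows "hom_odd (pruned_vimage F G \<phi> S) (induced G S) \<phi> a \<longleftrightarrow> hom_odd F G \<phi> a"
proof -
  have "odd (card (fibre_neighbours (pruned_vimage F G \<phi> S) \<phi> a v)) \<longleftrightarrow> hom_odd F G \<phi> a"
    if v: "v \<in> neighbourhood (induced G S) (\<phi> a)" for v
  proof -
    have "v \<in> neighbourhood G (\<phi> a)"
      using v by (auto simp: neighbourhood_def)
    then show ?thesis
      using hom_odd_iff_fibre_neighbours[OF assms(1) pverts_pruned_vimageD(1)[OF assms(2)]]
        fibre_neighbours_pruned_vimage[OF parity_hom_pair_graph(2)[OF assms(1)] assms(2) v]
      by simp
  qed
  then show ?thesis
    using pverts_pruned_vimageD(2)[OF assms(2)]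
    unfolding hom_odd_def[of "pruned_vimage F G \<phi> S"] by blast
qed

lemma hom_even_pruned_vimage:
  assumes "pair_graph G" "hom_even F G \<phi> a" "a \<in> pverts (pruned_vimage F G \<phi> S)"
  shows "hom_even (pruned_vimage F G \<phi> S) (induced G S) \<phi> a"
  using assms(2) fibre_neighbours_pruned_vimage[OF assms(1,3)]
  by (simp add: hom_even_def neighbourhood_def)

lemma parity_hom_pruned_vimage:
  assumes "parity_hom F G \<phi>"
  shows "parity_hom (pruned_vimage F G \<phi> S) (induced G S) \<phi>"
proof -
  have hom: "graph_hom F G \<phi>"
    and parity: "\<And>a. a \<in> pverts F \<Longrightarrow> hom_odd F G \<phi> a \<or> hom_even F G \<phi> a"
    using assms by (auto simp: parity_hom_def)
  have "hom_odd (pruned_vimage F G \<phi> S) (induced G S) \<phi> a \<or>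
      hom_even (pruned_vimage F G \<phi> S) (induced G S) \<phi> a"
    if a: "a \<in> pverts (pruned_vimage F G \<phi> S)" for a
    using parity[OF pverts_pruned_vimageD(1)[OF a]] hom_odd_pruned_vimage_iff[OF assms a]
      hom_even_pruned_vimage[OF parity_hom_pair_graph(2)[OF assms] _ a]
    by blast
  with graph_hom_pruned_vimage[OF hom] show ?thesis
    by (simp add: parity_hom_def)
qed

lemma odd_fibre_pruned_vimage:
  assumes "parity_hom F G \<phi>" "v \<in> S"
  shows "odd_fibre (pruned_vimage F G \<phi> S) (induced G S) \<phi> v = odd_fibre F G \<phi> v"
proof -
  have "a \<in> odd_fibre F G \<phi> v \<longleftrightarrow>
      a \<in> pverts (pruned_vimage F G \<phi> S) \<and> \<phi> a = v \<and> hom_odd F G \<phi> a" for a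
    using assms(2) by (auto simp: odd_fibre_def fibre_def pruned_vimage_def)
  then show ?thesis
    using hom_odd_pruned_vimage_iff[OF assms(1)]
    by (auto simp: odd_fibre_def[of "pruned_vimage F G \<phi> S"] fibre_def)
qed

lemma oddomorphism_pruned_vimage:
  "oddomorphism F G \<phi> \<Longrightarrow> oddomorphism (pruned_vimage F G \<phi> S) (induced G S) \<phi>"
  by (simp add: oddomorphism_iff_odd_fibres parity_hom_pruned_vimage odd_fibre_pruned_vimage)

section \<open>Weak odd images\<close>

text \<open>
  Unlike for \<^term>\<open>weak_oddomorphism\<close>, no homomorphism from all of \<open>F\<close> to \<open>G\<close> is required: deleting
  a vertex \<open>v\<close> from \<open>F\<close> and \<open>\<phi> v\<close> from \<open>G\<close> may leave none.
\<close>

definition weak_odd_image :: "'b pair_pre_digraph \<Rightarrow> 'a pair_pre_digraph \<Rightarrow> bool" where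
  "weak_odd_image G F \<longleftrightarrow> (\<exists>H \<phi>. is_subgraph H F \<and> oddomorphism H G \<phi>)"

lemma weak_oddomorphism_imp_weak_odd_image: "weak_oddomorphism F G \<phi> \<Longrightarrow> weak_odd_image G F"
  by (auto simp: weak_oddomorphism_def weak_odd_image_def)

lemma oddomorphism_imp_weak_oddomorphism: "oddomorphism F G \<phi> \<Longrightarrow> weak_oddomorphism F G \<phi>"
  using is_subgraph_refl unfolding weak_oddomorphism_def oddomorphism_def graph_hom_def by blast

lemma weak_odd_image_pair_graph:
  "weak_odd_image G F \<Longrightarrow> pair_graph G"
  "weak_odd_image G F \<Longrightarrow> pair_graph F"
  by (auto simp: weak_odd_image_def oddomorphism_def graph_hom_def is_subgraph_def)

lemma weak_odd_image_mono: "weak_odd_image G H \<Longrightarrow> is_subgraph H F \<Longrightarrow> weak_odd_image G F"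
  by (auto simp: weak_odd_image_def intro: is_subgraph_trans)

lemma weak_odd_image_in_class:
  assumes "subgraph_closed \<F>" "weak_oddomorphism_closed \<F>" "F \<in> \<F>" "weak_odd_image G F"
  shows "G \<in> \<F>"
proof -
  obtain H \<phi> where H: "is_subgraph H F" "oddomorphism H G \<phi>"
    using assms(4) by (auto simp: weak_odd_image_def)
  then have "weak_oddomorphism H G \<phi>"
    by (intro oddomorphism_imp_weak_oddomorphism)
  with H(1) show ?thesis
    using assms(1-3) unfolding subgraph_closed_def weak_oddomorphism_closed_def by blast
qed

lemma weak_odd_image_of_component:
  assumes "weak_odd_image G F" "connected (with_proj G)"
  obtains C where "C \<in> components F" "weak_odd_image G C"
proof -
  obtain H \<phi> where H: "is_subgraph H F" "oddomorphism H G \<phi>"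
    using assms(1) by (auto simp: weak_odd_image_def)
  interpret F: pair_graph F
    using H(1) by (simp add: is_subgraph_def)
  interpret H: pair_graph H
    using H(1) by (simp add: is_subgraph_def)
  obtain D where D: "D \<in> components H" "oddomorphism D G \<phi>"
    using H(2) assms(2) by (rule oddomorphism_component)
  have "is_subgraph D F"
    using H.is_subgraph_component[OF D(1)] H(1) by (rule is_subgraph_trans)
  moreover have "connected (with_proj D)"
    using D(1) by (rule component_imp_connected)
  ultimately obtain C where "C \<in> components F" "is_subgraph D C"
    by (rule F.connected_subgraph_of_component)
  with D(2) show thesis
    using that by (auto simp: weak_odd_image_def)
qed

lemma weak_odd_image_induced_vimage:
  assumes "oddomorphism F G \<phi>"
  shows "weak_odd_image (induced G S) (induced F (\<phi> -` S))"
proof -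
  have "pair_graph F"
    using assms by (simp add: oddomorphism_def graph_hom_def)
  then show ?thesis
    unfolding weak_odd_image_def
    using is_subgraph_pruned_vimage oddomorphism_pruned_vimage[OF assms] by blast
qed

lemma weak_odd_image_induced:
  assumes "weak_odd_image G F"
  shows "weak_odd_image (induced G S) F"
proof -
  obtain H \<phi> where H: "is_subgraph H F" "oddomorphism H G \<phi>"
    using assms by (auto simp: weak_odd_image_def)
  have "is_subgraph (induced H (\<phi> -` S)) F"
    using H(1) is_subgraph_induced is_subgraph_trans unfolding is_subgraph_def by blast
  with weak_odd_image_induced_vimage[OF H(2)] show ?thesis
    by (rule weak_odd_image_mono)
qed

lemma weak_odd_image_delete_vertex:
  assumes "weak_odd_image G F" "pverts G \<noteq> {}"
  obtains w where "w \<in> pverts G" "weak_odd_image (delete_vertex G w) (delete_vertex F v)"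
proof -
  obtain H \<phi> where H: "is_subgraph H F" "oddomorphism H G \<phi>"
    using assms by (auto simp: weak_odd_image_def)
  obtain w where w: "w \<in> pverts G" "v \<in> pverts H \<Longrightarrow> \<phi> v = w"
    using assms(2) H(2) unfolding oddomorphism_def graph_hom_def by blast
  let ?K = "induced H (\<phi> -` (- {w}))"
  have "is_subgraph ?K F" "v \<notin> pverts ?K"
    using H(1) w(2) by (auto simp: is_subgraph_iff pair_graph_induced)
  then have "is_subgraph ?K (delete_vertex F v)"
    by (simp add: delete_vertex_eq_induced is_subgraph_induced_iff subset_Compl_singleton
        weak_odd_image_pair_graph[OF assms(1)])
  with weak_odd_image_induced_vimage[OF H(2)]
  have "weak_odd_image (induced G (- {w})) (delete_vertex F v)"
    by (rule weak_odd_image_mono)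
  then have "weak_odd_image (delete_vertex G w) (delete_vertex F v)"
    by (simp add: delete_vertex_eq_induced weak_odd_image_pair_graph[OF assms(1)])
  with w(1) show thesis
    by (rule that)
qed

section \<open>Elimination distance\<close>

lemma elim_dist_eq_0: "pair_graph F \<Longrightarrow> F \<in> \<F> \<or> pverts F = {} \<Longrightarrow> elim_dist \<F> F = 0"
  by (simp add: elim_dist.simps)

lemma elim_dist_le_Suc_delete_vertex:
  assumes "pair_graph F" "connected (with_proj F)" "v \<in> pverts F"
  shows "elim_dist \<F> F \<le> Suc (elim_dist \<F> (delete_vertex F v))"
proof -
  have "(MIN v\<in>pverts F. elim_dist \<F> (delete_vertex F v)) \<le> elim_dist \<F> (delete_vertex F v)"
    using assms by (intro Min_le) (auto simp: pair_graph_iff)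
  then show ?thesis
    using assms by (simp add: elim_dist.simps[of \<F> F])
qed

lemma elim_dist_eq_Suc_delete_vertex:
  assumes "pair_graph F" "F \<notin> \<F>" "connected (with_proj F)"
  obtains v where "v \<in> pverts F" "elim_dist \<F> F = Suc (elim_dist \<F> (delete_vertex F v))"
proof -
  let ?ed = "\<lambda>v. elim_dist \<F> (delete_vertex F v)"
  have F: "pverts F \<noteq> {}" "finite (pverts F)"
    using assms by (auto simp: connected_conv pair_graph_iff)
  then have "Min (?ed ` pverts F) \<in> ?ed ` pverts F"
    by (intro Min_in) auto
  then obtain v where "v \<in> pverts F" "Min (?ed ` pverts F) = ?ed v"
    by auto
  with assms F show thesis
    by (intro that[of v]) (simp_all add: elim_dist.simps[of \<F> F])
qed

lemma elim_dist_component_le: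
  assumes "pair_graph F" "F \<notin> \<F>" "C \<in> components F"
  shows "elim_dist \<F> C \<le> elim_dist \<F> F"
proof (cases "connected (with_proj F)")
  case True
  then show ?thesis
    using assms by (simp add: pair_graph.components_eq_singleton)
next
  case False
  have "pverts F \<noteq> {}"
    using component_imp_connected[OF assms(3)] pair_graph.is_subgraph_component[OF assms(1,3)]
    by (auto simp: connected_conv is_subgraph_iff)
  with False show ?thesis
    using assms pair_graph.finite_components[OF assms(1)] by (simp add: elim_dist.simps[of \<F> F])
qed

lemma elim_dist_le_if_components_le:
  assumes "pair_graph F" "\<And>C. C \<in> components F \<Longrightarrow> elim_dist \<F> C \<le> d"
  shows "elim_dist \<F> F \<le> d"
proof -
  interpret pair_graph F by fact
  consider (base) "F \<in> \<F> \<or> pverts F = {}" | (connected) "connected (with_proj F)"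
    | (disconnected) "F \<notin> \<F>" "pverts F \<noteq> {}" "\<not> connected (with_proj F)"
    by blast
  then show ?thesis
  proof cases
    case base
    with assms(1) show ?thesis
      by (simp add: elim_dist_eq_0)
  next
    case connected
    then show ?thesis
      using assms(2) by (simp add: components_eq_singleton)
  next
    case disconnected
    then have "components F \<noteq> {}"
      using Union_pverts_components by auto
    with disconnected show ?thesis
      using assms finite_components by (simp add: elim_dist.simps[of \<F> F])
  qed
qed

lemma elim_dist_le_if_connected_images_le:
  assumes "weak_odd_image G F"
    and "\<And>C. connected (with_proj C) \<Longrightarrow> weak_odd_image C F \<Longrightarrow> elim_dist \<F> C \<le> d"
  shows "elim_dist \<F> G \<le> d"
proof -
  interpret pair_graph G
    using assms(1) by (rule weak_odd_image_pair_graph)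
  show ?thesis
  proof (rule elim_dist_le_if_components_le[OF pair_graph])
    fix C
    assume C: "C \<in> components G"
    then have "weak_odd_image C F"
      using weak_odd_image_induced[OF assms(1)] component_eq_induced by metis
    with component_imp_connected[OF C] show "elim_dist \<F> C \<le> d"
      by (rule assms(2))
  qed
qed

lemma elim_dist_image_le_if_delete_vertex:
  assumes image: "weak_odd_image C F" and C: "connected (with_proj C)"
    and F: "F \<notin> \<F>" "connected (with_proj F)"
    and delete_vertex: "\<And>v G. v \<in> pverts F \<Longrightarrow> weak_odd_image G (delete_vertex F v) \<Longrightarrow>
      elim_dist \<F> G \<le> elim_dist \<F> (delete_vertex F v)"
  shows "elim_dist \<F> C \<le> elim_dist \<F> F"
proof -
  note graphs = weak_odd_image_pair_graph[OF image]
  obtain v where v: "v \<in> pverts F" "elim_dist \<F> F = Suc (elim_dist \<F> (delete_vertex F v))"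
    using graphs(2) F by (rule elim_dist_eq_Suc_delete_vertex)
  have "pverts C \<noteq> {}"
    using C by (simp add: connected_conv)
  with image obtain w
    where w: "w \<in> pverts C" "weak_odd_image (delete_vertex C w) (delete_vertex F v)"
    by (rule weak_odd_image_delete_vertex)
  have "elim_dist \<F> C \<le> Suc (elim_dist \<F> (delete_vertex C w))"
    using graphs(1) C w(1) by (rule elim_dist_le_Suc_delete_vertex)
  also have "\<dots> \<le> elim_dist \<F> F"
    using delete_vertex[OF v(1) w(2)] v(2) by simp
  finally show ?thesis .
qed

lemma elim_dist_image_le_if_components:
  assumes image: "weak_odd_image C F" and C: "connected (with_proj C)" and F: "F \<notin> \<F>"
    and components: "\<And>D G. D \<in> components F \<Longrightarrow> weak_odd_image G D \<Longrightarrow>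
      elim_dist \<F> G \<le> elim_dist \<F> D"
  shows "elim_dist \<F> C \<le> elim_dist \<F> F"
proof -
  obtain D where D: "D \<in> components F" "weak_odd_image C D"
    using image C by (rule weak_odd_image_of_component)
  then have "elim_dist \<F> C \<le> elim_dist \<F> D"
    by (rule components)
  also have "\<dots> \<le> elim_dist \<F> F"
    using weak_odd_image_pair_graph(2)[OF image] F D(1) by (rule elim_dist_component_le)
  finally show ?thesis .
qed

lemma elim_dist_weak_odd_image_le:
  fixes F G :: "'a pair_pre_digraph"
  assumes closed: "subgraph_closed \<F>" "weak_oddomorphism_closed \<F>" and "weak_odd_image G F"
  shows "elim_dist \<F> G \<le> elim_dist \<F> F"
  using assms(3)
proof (induction "card (pverts F)" arbitrary: F G rule: less_induct)
  case less
  note F = weak_odd_image_pair_graph(2)[OF less.prems]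
  show ?case
    using less.prems
  proof (rule elim_dist_le_if_connected_images_le)
    fix C :: "'a pair_pre_digraph"
    assume C: "connected (with_proj C)" and image: "weak_odd_image C F"
    consider (in_class) "F \<in> \<F>" | (connected) "F \<notin> \<F>" "connected (with_proj F)"
      | (disconnected) "F \<notin> \<F>" "\<not> connected (with_proj F)"
      by blast
    then show "elim_dist \<F> C \<le> elim_dist \<F> F"
    proof cases
      case in_class
      then have "C \<in> \<F>"
        using image by (rule weak_odd_image_in_class[OF closed])
      then show ?thesis
        using weak_odd_image_pair_graph(1)[OF image] by (simp add: elim_dist_eq_0)
    next
      case connected
      show ?thesis
        using image C connected less.hyps[OF card_delete_vertex_less[OF F]]
        by (rule elim_dist_image_le_if_delete_vertex)
    next
      case disconnected
      show ?thesis
        using image C disconnected(1) less.hyps[OF card_component_less[OF F disconnected(2)]]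
        by (rule elim_dist_image_le_if_components)
    qed
  qed
qed

theorem theorem3p6:
  fixes \<F> :: "'a pair_pre_digraph set" and d :: nat
  assumes "graph_class \<F>" and "subgraph_closed \<F>" and "weak_oddomorphism_closed \<F>"
  shows "weak_oddomorphism_closed {F. pair_graph F \<and> elim_dist \<F> F \<le> d}"
  unfolding weak_oddomorphism_closed_def
proof (intro allI impI, elim conjE exE)
  fix F G :: "'a pair_pre_digraph" and \<phi>
  assume F: "F \<in> {F. pair_graph F \<and> elim_dist \<F> F \<le> d}" and "weak_oddomorphism F G \<phi>"
  then have image: "weak_odd_image G F"
    by (intro weak_oddomorphism_imp_weak_odd_image)
  then have "elim_dist \<F> G \<le> elim_dist \<F> F"
    by (rule elim_dist_weak_odd_image_le[OF assms(2,3)])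
  with F show "G \<in> {F. pair_graph F \<and> elim_dist \<F> F \<le> d}"
    using weak_odd_image_pair_graph(1)[OF image] by simp
qed

end
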